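(* Let $\mathbf{x}_1,\dots,\mathbf{x}_n\in\mathbb{R}^p$ with $\|\mathbf{x}_i\|\le R$, let $\mathbf{y}\in\{-1,1\}^n$, let $\Delta(\cdot,\mathbf{y}):\{-1,1\}^n\to\mathbb{R}\cup\{-\infty\}$ be finite for at least one argument, and let $$R_{\mathrm{emp}}(\mathbf{w})=\max_{\mathbf{z}\in\{-1,1\}^n}\Big[\Delta(\mathbf{z},\mathbf{y})+\frac1n\sum_{i=1}^n\langle\mathbf{w},\mathbf{x}_i\rangle(z_i-y_i)\Big],\qquad\mathbf{w}\in\mathbb{R}^p.$$ For $\boldsymbol\beta\in[0,1]^n$ define $$g(\boldsymbol\beta)=-\max_{\boldsymbol\alpha\in\mathcal{A}(\boldsymbol\beta)}\sum_{\mathbf{z}\in\{-1,1\}^n}\alpha_{\mathbf{z}}\Delta(\mathbf{z},\mathbf{y}),$$ where $\mathcal{A}(\boldsymbol\beta)$ is the set of probability vectors $\boldsymbol\alpha=(\alpha_{\mathbf{z}})_{\mathbf{z}\in\{-1,1\}^n}$ with $\sum_{\mathbf{z}:z_i=-y_i}\alpha_{\mathbf{z}}=\beta_i$ for all $i$; set $g=+\infty$ outside $[0,1]^n$. Let $A$ be the $p\times n$ matrix whose $i$-th column is $\frac{-2}{n}y_i\mathbf{x}_i$. Then $g$ is convex and $$R_{\mathrm{emp}}(\mathbf{w})=g^\star(A^\top\mathbf{w})\quad\text{for all }\mathbf{w}\in\mathbb{R}^p .$$ Moreover, with $d(\boldsymbol\beta)=\frac12\|\boldsymbol\beta\|^2$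 and $D=\max_{\boldsymbol\beta\in[0,1]^n}d(\boldsymbol\beta)$, $$\sqrt{D}\,\|A\|\le\sqrt2\,R .$$
   Context: $g^\star(\mathbf{u})=\sup_{\boldsymbol\beta}\{\langle\boldsymbol\beta,\mathbf{u}\rangle-g(\boldsymbol\beta)\}$ is the Fenchel dual; $\|\cdot\|$ on vectors is the Euclidean norm and $\|A\|=\max_{\|\mathbf{w}\|=\|\boldsymbol\beta\|=1}\mathbf{w}^\top A\boldsymbol\beta$. Conventions: $0\cdot(-\infty)=0$; $g(\boldsymbol\beta)=+\infty$ is allowed, and occurs when every $\boldsymbol\alpha\in\mathcal{A}(\boldsymbol\beta)$ puts positive mass on some $\mathbf{z}$ with $\Delta(\mathbf{z},\mathbf{y})=-\infty$. The motivating case is the precision/recall break-even point: with $n_+$ the number of $i$ with $y_i=1$, $b=|\{i:y_i=1,z_i=-1\}|$ and $c=|\{j:y_j=-1,z_j=1\}|$, $\Delta(\mathbf{z},\mathbf{y})=b/n_+$ if $b=c$ and $-\infty$ otherwise. *)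

theory Defs
  imports "HOL-Analysis.Analysis"
begin

text \<open>
  The sample size \<open>n\<close> and the feature dimension \<open>p\<close> are the cardinalities of the finite index
  types \<open>'n\<close> and \<open>'p\<close>. Extended-real values have type \<^typ>\<open>ereal\<close>, where \<open>0 * (-\<infinity>) = 0\<close>.
\<close>

text \<open>
  The maximum of \<open>f\<close> over a possibly infinite set, i.e. the greatest element of the image.
  It is unspecified when the maximum is not attained, so a statement about it
  implicitly claims attainment (unlike one about \<^const>\<open>Sup\<close>).
\<close>
definition max_over :: "'a set \<Rightarrow> ('a \<Rightarrow> 'b::order) \<Rightarrow> 'b" where
  "max_over S f = (GREATEST v. v \<in> f ` S)"

definition sign_vectors :: "(real^'n) set" where
  "sign_vectors = {z. \<forall>i. z $ i \<in> {-1, 1}}"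

definition unit_cube :: "(real^'n) set" where
  "unit_cube = {\<beta>. \<forall>i. \<beta> $ i \<in> {0..1}}"

definition R_emp ::
  "(real^'n \<Rightarrow> real^'n \<Rightarrow> ereal) \<Rightarrow> ('n::finite \<Rightarrow> real^'p::finite) \<Rightarrow> real^'n \<Rightarrow> real^'p \<Rightarrow> ereal" where
  "R_emp \<Delta> x y w =
     (MAX z\<in>sign_vectors.
        \<Delta> z y + ereal (1 / real CARD('n) * (\<Sum>i\<in>UNIV. (w \<bullet> x i) * (z $ i - y $ i))))"

text \<open>
  Only the values of \<open>\<alpha>\<close> on sign vectors are meaningful; they are left arbitrary elsewhere.
\<close>
definition prob_vectors :: "real^'n \<Rightarrow> real^'n \<Rightarrow> (real^'n::finite \<Rightarrow> real) set" where
  "prob_vectors y \<beta> =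
     {\<alpha>. (\<forall>z\<in>sign_vectors. 0 \<le> \<alpha> z) \<and> (\<Sum>z\<in>sign_vectors. \<alpha> z) = 1 \<and>
         (\<forall>i. (\<Sum>z\<in>{z\<in>sign_vectors. z $ i = - y $ i}. \<alpha> z) = \<beta> $ i)}"

definition g_fun :: "(real^'n \<Rightarrow> real^'n \<Rightarrow> ereal) \<Rightarrow> real^'n \<Rightarrow> real^'n::finite \<Rightarrow> ereal" where
  "g_fun \<Delta> y \<beta> =
     (if \<beta> \<in> unit_cube
      then - max_over (prob_vectors y \<beta>) (\<lambda>\<alpha>. \<Sum>z\<in>sign_vectors. ereal (\<alpha> z) * \<Delta> z y)
      else \<infinity>)"

definition fenchel_dual :: "('a::real_inner \<Rightarrow> ereal) \<Rightarrow> 'a \<Rightarrow> ereal" where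
  "fenchel_dual g u = (SUP \<beta>. ereal (\<beta> \<bullet> u) - g \<beta>)"

text \<open>
  The library's \<^const>\<open>convex_on\<close> covers real-valued functions only. Since \<open>\<infinity> + (-\<infinity>) = \<infinity>\<close> in
  \<^typ>\<open>ereal\<close>, this is convexity of the epigraph even for functions that take both infinite values.
\<close>
definition ereal_convex :: "('a::real_vector \<Rightarrow> ereal) \<Rightarrow> bool" where
  "ereal_convex f \<longleftrightarrow>
     (\<forall>a b t. 0 < t \<longrightarrow> t < 1 \<longrightarrow>
        f ((1 - t) *\<^sub>R a + t *\<^sub>R b) \<le> ereal (1 - t) * f a + ereal t * f b)"

definition data_matrix :: "('n::finite \<Rightarrow> real^'p::finite) \<Rightarrow> real^'n \<Rightarrow> real^'n^'p" where
  "data_matrix x y = (\<chi> j i. (((- 2 / real CARD('n)) * y $ i) *\<^sub>R x i) $ j)"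

definition mat_norm :: "real^'n^'p \<Rightarrow> real" where
  "mat_norm A =
     max_over {(w :: real^'p, \<beta> :: real^'n). norm w = 1 \<and> norm \<beta> = 1} (\<lambda>(w, \<beta>). w \<bullet> (A *v \<beta>))"

definition prox_d :: "real^'n \<Rightarrow> real" where
  "prox_d \<beta> = 1 / 2 * (norm \<beta>)\<^sup>2"

end

(*
  Let H be the convex hull of the finitely many points (b(z), Delta(z, y)) with Delta(z, y) finite,
  where b(z) is the 0/1 vector marking the i with z_i = - y_i. This polytope is compact, and - g(beta)
  is the height of its upper boundary above beta (minus infinity off its projection). Hence g is
  convex, and the supremum of <beta, u> - g(beta) is that of a linear functional on H, so it is
  attained at a vertex: the maximum over z of <b(z), u> + Delta(z, y).

  The norm bound is Cauchy-Schwarz: D = n/2, and |(A^T w)_i| <= 2R/n gives ||A|| <= 2R/sqrt n.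
*)

theory Submission
  imports Defs
begin

section \<open>Sign vectors, attained maxima and weights on finite convex hulls\<close>

lemma finite_sign_vectors: "finite (sign_vectors :: (real^'n::finite) set)"
proof -
  have "(sign_vectors :: (real^'n) set) \<subseteq> vec_lambda ` (UNIV \<rightarrow>\<^sub>E {-1, 1})"
  proof
    fix z :: "real^'n" assume "z \<in> sign_vectors"
    then have "vec_nth z \<in> UNIV \<rightarrow>\<^sub>E {-1, 1}" by (auto simp: sign_vectors_def)
    then show "z \<in> vec_lambda ` (UNIV \<rightarrow>\<^sub>E {-1, 1})" by (metis image_eqI vec_nth_inverse)
  qed
  then show ?thesis
    by (rule finite_subset) (auto intro!: finite_PiE)
qed

lemma max_over_eqI:
  assumes "a \<in> S" and "\<And>b. b \<in> S \<Longrightarrow> f b \<le> f a"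
  shows "max_over S f = f a"
  unfolding max_over_def by (rule Greatest_equality) (use assms in auto)

text \<open>The weights sit on indices rather than on points, so that they can be read as
  probability vectors over sign vectors. Injectivity makes the re-indexing possible.\<close>

lemma convex_hull_finite_image_iff:
  fixes f :: "'a \<Rightarrow> 'b::real_vector"
  assumes "finite I" and "inj_on f I"
  shows "p \<in> convex hull (f ` I) \<longleftrightarrow>
    (\<exists>u. (\<forall>i\<in>I. 0 \<le> u i) \<and> sum u I = 1 \<and> (\<Sum>i\<in>I. u i *\<^sub>R f i) = p)" (is "?L \<longleftrightarrow> ?R")
proof
  assume ?L
  then obtain u where "\<forall>q\<in>f ` I. 0 \<le> u q" "sum u (f ` I) = 1" "(\<Sum>q\<in>f ` I. u q *\<^sub>R q) = p"
    using assms(1) by (auto simp: convex_hull_finite)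
  then show ?R
    using assms(2) by (intro exI[of _ "u \<circ> f"]) (auto simp: sum.reindex)
next
  assume ?R
  then obtain u where u: "\<forall>i\<in>I. 0 \<le> u i" "sum u I = 1" "(\<Sum>i\<in>I. u i *\<^sub>R f i) = p" by blast
  have "(\<Sum>i\<in>I. u i *\<^sub>R f i) \<in> convex hull (f ` I)"
    by (rule convex_sum) (use u assms(1) in \<open>auto simp: hull_inc\<close>)
  with u show ?L by simp
qed

section \<open>Mismatch vectors as the vertices of the unit cube\<close>

definition mismatch :: "real^'n \<Rightarrow> real^'n \<Rightarrow> real^'n" where
  "mismatch y z = (\<chi> i. (1 - z $ i * y $ i) / 2)"

lemma sign_nth:
  assumes "z \<in> sign_vectors"
  shows "z $ i = 1 \<or> z $ i = -1"
  using assms by (auto simp: sign_vectors_def)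

lemma mismatch_nth:
  assumes "y \<in> sign_vectors" and "z \<in> sign_vectors"
  shows "mismatch y z $ i = (if z $ i = - y $ i then 1 else 0)"
  using sign_nth[OF assms(1), of i] sign_nth[OF assms(2), of i] by (auto simp: mismatch_def)

lemma inj_on_mismatch:
  assumes "y \<in> sign_vectors"
  shows "inj_on (mismatch y) sign_vectors"
proof (rule inj_onI)
  fix a b assume *: "a \<in> sign_vectors" "b \<in> sign_vectors" "mismatch y a = mismatch y b"
  have "a $ i = b $ i" for i
    using sign_nth[OF assms, of i] sign_nth[OF *(1), of i] sign_nth[OF *(2), of i]
      arg_cong[OF *(3), of "\<lambda>v. v $ i"] by (auto simp: mismatch_def)
  then show "a = b" by (simp add: vec_eq_iff)
qed

lemma mismatch_image:
  assumes "y \<in> sign_vectors"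
  shows "mismatch y ` sign_vectors = {b. \<forall>i. b $ i = 0 \<or> b $ i = 1}"
proof (intro set_eqI iffI)
  fix b assume "b \<in> mismatch y ` sign_vectors"
  then show "b \<in> {b. \<forall>i. b $ i = 0 \<or> b $ i = 1}"
    using mismatch_nth[OF assms] by auto
next
  fix b :: "real^'a" assume "b \<in> {b. \<forall>i. b $ i = 0 \<or> b $ i = 1}"
  then have b: "b $ i = 0 \<or> b $ i = 1" for i by blast
  \<comment> \<open>Flips the sign of \<open>y\<close> exactly where \<open>b\<close> is 1.\<close>
  define z where "z = (\<chi> i. (1 - 2 * b $ i) * y $ i)"
  have "z $ i \<in> {-1, 1}" for i
    using b[of i] sign_nth[OF assms, of i] by (auto simp: z_def)
  then have "z \<in> sign_vectors" by (simp add: sign_vectors_def)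
  moreover have "mismatch y z $ i = b $ i" for i
    using b[of i] sign_nth[OF assms, of i] by (auto simp: z_def mismatch_def)
  then have "mismatch y z = b" by (simp add: vec_eq_iff)
  ultimately show "b \<in> mismatch y ` sign_vectors" by blast
qed

lemma unit_cube_eq_convex_hull:
  assumes "y \<in> sign_vectors"
  shows "unit_cube = convex hull (mismatch y ` (sign_vectors :: (real^'n::finite) set))"
proof -
  have "(unit_cube :: (real^'n) set) = cbox 0 1"
    by (auto simp: unit_cube_def mem_box_cart)
  then show ?thesis
    unfolding mismatch_image[OF assms] Cart_1 unit_interval_convex_hull
    by (simp add: Basis_vec_def inner_axis)
qed

text \<open>Summing \<alpha> over the \<open>z\<close> that disagree with \<open>y\<close> at
  \<open>i\<close> averages the \<open>i\<close>-th mismatch bit, so the marginal constraints say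
  that \<beta> is the barycentre of the mismatch vectors with weights \<alpha>.\<close>

lemma prob_vectors_iff:
  assumes "y \<in> sign_vectors"
  shows "\<alpha> \<in> prob_vectors y \<beta> \<longleftrightarrow>
    (\<forall>z\<in>sign_vectors. 0 \<le> \<alpha> z) \<and> sum \<alpha> sign_vectors = 1 \<and>
    (\<Sum>z\<in>sign_vectors. \<alpha> z *\<^sub>R mismatch y z) = \<beta>"
proof -
  have "(\<Sum>z\<in>{z\<in>sign_vectors. z $ i = - y $ i}. \<alpha> z) = (\<Sum>z\<in>sign_vectors. \<alpha> z *\<^sub>R mismatch y z) $ i" for i
    unfolding sum_component
    by (rule sum.mono_neutral_cong_left) (auto simp: finite_sign_vectors mismatch_nth[OF assms])
  then show ?thesis by (auto simp: prob_vectors_def vec_eq_iff)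
qed

text \<open>Every point of the cube is a convex combination of its vertices. Without a feasible
  \<alpha>, the \<open>max_over\<close> inside \<open>g_fun\<close> would be unspecified.\<close>

lemma prob_vectors_nonempty:
  assumes "y \<in> sign_vectors" and "\<beta> \<in> unit_cube"
  shows "prob_vectors y \<beta> \<noteq> {}"
proof -
  have "\<beta> \<in> convex hull (mismatch y ` sign_vectors)"
    using assms unit_cube_eq_convex_hull by blast
  then show ?thesis
    unfolding convex_hull_finite_image_iff[OF finite_sign_vectors inj_on_mismatch[OF assms(1)]]
    using prob_vectors_iff[OF assms(1)] by blast
qed

section \<open>The polytope of attainable pairs\<close>

definition attainable :: "(real^'n \<Rightarrow> real^'n \<Rightarrow> ereal) \<Rightarrow> real^'n \<Rightarrow> ((real^'n::finite) \<times> real) set" where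
  "attainable \<Delta> y = convex hull
     ((\<lambda>z. (mismatch y z, real_of_ereal (\<Delta> z y))) ` {z \<in> sign_vectors. \<Delta> z y \<noteq> - \<infinity>})"

text \<open>In \<open>ereal\<close>, -\<infinity> + \<infinity> = \<infinity>, so a term
  -\<infinity> decides the sum only when no term is \<infinity>.\<close>

lemma sum_ereal_eq_MInfty:
  fixes f :: "'a \<Rightarrow> ereal"
  assumes "finite I" and "i \<in> I" and "f i = - \<infinity>" and "\<And>j. j \<in> I \<Longrightarrow> f j \<noteq> \<infinity>"
  shows "sum f I = - \<infinity>"
proof -
  have "sum f (I - {i}) \<noteq> \<infinity>" using assms by (simp add: sum_Pinfty)
  then show ?thesis using assms by (simp add: sum.remove)
qed

context
  fixes \<Delta> :: "real^'n::finite \<Rightarrow> real^'n \<Rightarrow> ereal" and y :: "real^'n"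
  assumes y: "y \<in> sign_vectors"
    and Delta_not_PInfty: "\<And>z. z \<in> sign_vectors \<Longrightarrow> \<Delta> z y \<noteq> \<infinity>"
begin

text \<open>Bridge between the polytope and the optimisation problem: a feasible \<alpha> has a
  finite objective exactly when it puts no mass where \<Delta> is -\<infinity>, and then it is a
  system of convex weights on the generators.\<close>

lemma mem_attainable_iff:
  "(\<beta>, v) \<in> attainable \<Delta> y \<longleftrightarrow>
    (\<exists>\<alpha>\<in>prob_vectors y \<beta>. (\<Sum>z\<in>sign_vectors. ereal (\<alpha> z) * \<Delta> z y) = ereal v)" (is "_ \<longleftrightarrow> ?R")
proof -
  define F where "F = {z \<in> sign_vectors. \<Delta> z y \<noteq> - \<infinity>}"
  let ?f = "\<lambda>z. (mismatch y z, real_of_ereal (\<Delta> z y))"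
  have F: "F \<subseteq> sign_vectors" "finite F" by (auto simp: F_def finite_sign_vectors)
  have inj: "inj_on ?f F"
    using inj_on_mismatch[OF y] F(1) by (auto simp: inj_on_def)
  \<comment> \<open>\<open>real_of_ereal\<close> loses nothing on \<open>F\<close>, where \<Delta>
    is neither -\<infinity> nor \<infinity>.\<close>
  have Delta: "\<Delta> z y = ereal (real_of_ereal (\<Delta> z y))" if "z \<in> F" for z
    using that Delta_not_PInfty by (auto simp: F_def ereal_real)
  have sumf: "(\<Sum>z\<in>F. u z *\<^sub>R ?f z) =
      (\<Sum>z\<in>F. u z *\<^sub>R mismatch y z, \<Sum>z\<in>F. u z * real_of_ereal (\<Delta> z y))" for u
    by (simp add: prod_eq_iff fst_sum snd_sum)
  have iff: "(\<beta>, v) \<in> attainable \<Delta> y \<longleftrightarrow> (\<exists>u. (\<forall>i\<in>F. 0 \<le> u i) \<and> sum u F = 1 \<and>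
      (\<Sum>z\<in>F. u z *\<^sub>R mismatch y z) = \<beta> \<and> (\<Sum>z\<in>F. u z * real_of_ereal (\<Delta> z y)) = v)"
    unfolding attainable_def F_def[symmetric] convex_hull_finite_image_iff[OF F(2) inj] sumf by simp
  \<comment> \<open>The convention 0 * (-\<infinity>) = 0 removes the terms outside \<open>F\<close>
    from the objective.\<close>
  have restrict: "sum \<alpha> sign_vectors = sum \<alpha> F"
    "(\<Sum>z\<in>sign_vectors. \<alpha> z *\<^sub>R mismatch y z) = (\<Sum>z\<in>F. \<alpha> z *\<^sub>R mismatch y z)"
    "(\<Sum>z\<in>sign_vectors. ereal (\<alpha> z) * \<Delta> z y) = ereal (\<Sum>z\<in>F. \<alpha> z * real_of_ereal (\<Delta> z y))"
    if "\<And>z. z \<in> sign_vectors - F \<Longrightarrow> \<alpha> z = 0" for \<alpha> :: "real^'n \<Rightarrow> real"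
  proof -
    show "sum \<alpha> sign_vectors = sum \<alpha> F"
      "(\<Sum>z\<in>sign_vectors. \<alpha> z *\<^sub>R mismatch y z) = (\<Sum>z\<in>F. \<alpha> z *\<^sub>R mismatch y z)"
      using F that by (auto intro!: sum.mono_neutral_right simp: finite_sign_vectors)
    have "(\<Sum>z\<in>sign_vectors. ereal (\<alpha> z) * \<Delta> z y) = (\<Sum>z\<in>F. ereal (\<alpha> z) * \<Delta> z y)"
      using F that by (intro sum.mono_neutral_right) (auto simp: finite_sign_vectors zero_ereal_def[symmetric])
    also have "\<dots> = (\<Sum>z\<in>F. ereal (\<alpha> z * real_of_ereal (\<Delta> z y)))"
      using Delta by (metis (no_types, lifting) sum.cong times_ereal.simps(1))
    finally show "(\<Sum>z\<in>sign_vectors. ereal (\<alpha> z) * \<Delta> z y) = ereal (\<Sum>z\<in>F. \<alpha> z * real_of_ereal (\<Delta> z y))"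
      by simp
  qed
  show ?thesis
  proof
    assume "(\<beta>, v) \<in> attainable \<Delta> y"
    then obtain u where u: "\<forall>i\<in>F. 0 \<le> u i" "sum u F = 1"
      "(\<Sum>z\<in>F. u z *\<^sub>R mismatch y z) = \<beta>" "(\<Sum>z\<in>F. u z * real_of_ereal (\<Delta> z y)) = v"
      unfolding iff by blast
    \<comment> \<open>Extension by zero, since nothing is known about \<open>u\<close> outside
      \<open>F\<close>.\<close>
    define \<alpha> where "\<alpha> z = (if z \<in> F then u z else 0)" for z
    have "(\<Sum>z\<in>F. \<alpha> z *\<^sub>R mismatch y z) = \<beta>" "(\<Sum>z\<in>F. \<alpha> z * real_of_ereal (\<Delta> z y)) = v" "sum \<alpha> F = 1"
      using u by (simp_all add: \<alpha>_def)
    moreover have "\<forall>z\<in>sign_vectors. 0 \<le> \<alpha> z" using u by (simp add: \<alpha>_def)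
    moreover have "\<And>z. z \<in> sign_vectors - F \<Longrightarrow> \<alpha> z = 0" by (simp add: \<alpha>_def)
    ultimately show ?R
      using restrict[of \<alpha>] prob_vectors_iff[OF y, of \<alpha> \<beta>] by auto
  next
    assume ?R
    then obtain \<alpha> where \<alpha>: "\<alpha> \<in> prob_vectors y \<beta>"
      and v: "(\<Sum>z\<in>sign_vectors. ereal (\<alpha> z) * \<Delta> z y) = ereal v" by blast
    have nonneg: "0 \<le> \<alpha> z" if "z \<in> sign_vectors" for z
      using \<alpha> that by (simp add: prob_vectors_def)
    \<comment> \<open>A positive weight outside \<open>F\<close> would contribute -\<infinity>; as
      no term is \<infinity>, the objective would be -\<infinity> rather than the real
      \<open>v\<close>.\<close>
    have "\<alpha> z = 0" if z: "z \<in> sign_vectors - F" for z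
    proof (rule ccontr)
      assume "\<alpha> z \<noteq> 0"
      then have "\<alpha> z > 0" using nonneg[of z] z by simp
      then have "ereal (\<alpha> z) * \<Delta> z y = - \<infinity>" using z by (simp add: F_def)
      moreover have "ereal (\<alpha> a) * \<Delta> a y \<noteq> \<infinity>" if "a \<in> sign_vectors" for a
        using nonneg[OF that] Delta_not_PInfty[OF that] by (cases "\<Delta> a y") auto
      ultimately have "(\<Sum>z\<in>sign_vectors. ereal (\<alpha> z) * \<Delta> z y) = - \<infinity>"
        using z by (intro sum_ereal_eq_MInfty[of _ z]) (auto simp: finite_sign_vectors)
      with v show False by simp
    qed
    from restrict[OF this] \<alpha> v F(1) show "(\<beta>, v) \<in> attainable \<Delta> y"
      unfolding iff prob_vectors_iff[OF y] by (intro exI[of _ \<alpha>]) auto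
  qed
qed

section \<open>The function g as the upper boundary of the polytope\<close>

lemma value_not_PInfty:
  assumes "\<alpha> \<in> prob_vectors y \<beta>"
  shows "(\<Sum>z\<in>sign_vectors. ereal (\<alpha> z) * \<Delta> z y) \<noteq> \<infinity>"
proof -
  have "ereal (\<alpha> a) * \<Delta> a y \<noteq> \<infinity>" if "a \<in> sign_vectors" for a
    using assms that Delta_not_PInfty[OF that] by (cases "\<Delta> a y") (auto simp: prob_vectors_def)
  then show ?thesis by (auto simp: sum_Pinfty)
qed

lemma compact_attainable: "compact (attainable \<Delta> y)"
  unfolding attainable_def
  by (rule finite_imp_compact_convex_hull) (simp add: finite_sign_vectors)

lemma convex_attainable: "convex (attainable \<Delta> y)"
  by (simp add: attainable_def convex_convex_hull)

lemma fst_attainable_in_unit_cube: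
  assumes "(\<beta>, v) \<in> attainable \<Delta> y"
  shows "\<beta> \<in> unit_cube"
proof -
  obtain \<alpha> where "\<alpha> \<in> prob_vectors y \<beta>" using assms unfolding mem_attainable_iff by blast
  then have "\<beta> \<in> convex hull (mismatch y ` sign_vectors)"
    unfolding convex_hull_finite_image_iff[OF finite_sign_vectors inj_on_mismatch[OF y]]
      prob_vectors_iff[OF y] by blast
  then show ?thesis using unit_cube_eq_convex_hull[OF y] by simp
qed

text \<open>Every competing \<alpha> has objective -\<infinity> or a real value that is itself a
  height over \<beta> in the polytope, so none exceeds the top height \<open>m\<close>.\<close>

lemma g_fun_eq:
  assumes "(\<beta>, m) \<in> attainable \<Delta> y" and "\<And>v. (\<beta>, v) \<in> attainable \<Delta> y \<Longrightarrow> v \<le> m"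
  shows "g_fun \<Delta> y \<beta> = - ereal m"
proof -
  let ?S = "\<lambda>\<alpha>. \<Sum>z\<in>sign_vectors. ereal (\<alpha> z) * \<Delta> z y"
  obtain \<alpha> where \<alpha>: "\<alpha> \<in> prob_vectors y \<beta>" "?S \<alpha> = ereal m"
    using assms(1) unfolding mem_attainable_iff by blast
  have "?S a \<le> ?S \<alpha>" if "a \<in> prob_vectors y \<beta>" for a
  proof (cases "?S a")
    case (real v)
    then have "v \<le> m" using that assms(2) mem_attainable_iff by blast
    with real \<alpha> show ?thesis by simp
  qed (use value_not_PInfty[OF that] in auto)
  with \<alpha> have "max_over (prob_vectors y \<beta>) ?S = ereal m"
    by (subst max_over_eqI[of \<alpha>]) auto
  then show ?thesis
    using fst_attainable_in_unit_cube[OF assms(1)] by (simp add: g_fun_def)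
qed

text \<open>Inside the cube feasible weights exist but all have objective -\<infinity>, so the
  maximum is attained and equals -\<infinity>. Outside, the value is \<infinity> by
  definition.\<close>

lemma g_fun_eq_PInfty:
  assumes "\<And>v. (\<beta>, v) \<notin> attainable \<Delta> y"
  shows "g_fun \<Delta> y \<beta> = \<infinity>"
proof (cases "\<beta> \<in> unit_cube")
  case True
  let ?S = "\<lambda>\<alpha>. \<Sum>z\<in>sign_vectors. ereal (\<alpha> z) * \<Delta> z y"
  have S: "?S a = - \<infinity>" if "a \<in> prob_vectors y \<beta>" for a
    using value_not_PInfty[OF that] assms that unfolding mem_attainable_iff by (cases "?S a") auto
  obtain \<alpha> where \<alpha>: "\<alpha> \<in> prob_vectors y \<beta>" using prob_vectors_nonempty[OF y True] by blast
  then have "max_over (prob_vectors y \<beta>) ?S = - \<infinity>"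
    by (subst max_over_eqI[of \<alpha>]) (auto simp: S)
  then show ?thesis by (simp add: g_fun_def)
qed (simp add: g_fun_def)

text \<open>The fibre of the compact polytope over \<beta> is compact and nonempty, so the height
  attains its maximum there.\<close>

lemma attainable_max:
  assumes "(\<beta>, v) \<in> attainable \<Delta> y"
  obtains m where "(\<beta>, m) \<in> attainable \<Delta> y" "\<And>v. (\<beta>, v) \<in> attainable \<Delta> y \<Longrightarrow> v \<le> m"
proof -
  have "compact (attainable \<Delta> y \<inter> {\<beta>} \<times> UNIV)"
    using compact_attainable by (intro compact_Int_closed closed_Times) auto
  moreover have "attainable \<Delta> y \<inter> {\<beta>} \<times> UNIV \<noteq> {}" using assms by blast
  ultimately obtain q where "q \<in> attainable \<Delta> y \<inter> {\<beta>} \<times> UNIV"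
    "\<forall>r\<in>attainable \<Delta> y \<inter> {\<beta>} \<times> UNIV. snd r \<le> snd q"
    using continuous_attains_sup[OF _ _ continuous_on_snd[OF continuous_on_id]] by blast
  then show ?thesis by (intro that[of "snd q"]) force+
qed

lemma g_fun_le:
  assumes "(\<beta>, v) \<in> attainable \<Delta> y"
  shows "g_fun \<Delta> y \<beta> \<le> - ereal v"
proof -
  obtain m where "(\<beta>, m) \<in> attainable \<Delta> y" "\<And>v. (\<beta>, v) \<in> attainable \<Delta> y \<Longrightarrow> v \<le> m"
    using attainable_max[OF assms] by blast
  then show ?thesis using g_fun_eq[of \<beta> m] assms by auto
qed

text \<open>Later arguments see g only through this dichotomy and \<open>g_fun_le\<close>: a value
  of g is \<infinity> or is realised by a point of the polytope, and any point of the polytope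
  bounds it from above.\<close>

lemma g_fun_cases:
  obtains "g_fun \<Delta> y \<beta> = \<infinity>"
  | v where "(\<beta>, v) \<in> attainable \<Delta> y" "g_fun \<Delta> y \<beta> = - ereal v"
proof (cases "\<exists>v. (\<beta>, v) \<in> attainable \<Delta> y")
  case True
  then obtain m where "(\<beta>, m) \<in> attainable \<Delta> y" "\<And>v. (\<beta>, v) \<in> attainable \<Delta> y \<Longrightarrow> v \<le> m"
    using attainable_max by blast
  with g_fun_eq that(2) show ?thesis by blast
next
  case False
  then show ?thesis using g_fun_eq_PInfty that(1) by blast
qed

section \<open>Convexity of g and its Fenchel dual\<close>

lemma ereal_convex_g_fun: "ereal_convex (g_fun \<Delta> y)"
  unfolding ereal_convex_def
proof (intro allI impI)
  fix a b :: "real^'n" and t :: real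
  assume t: "0 < t" "t < 1"
  show "g_fun \<Delta> y ((1 - t) *\<^sub>R a + t *\<^sub>R b) \<le> ereal (1 - t) * g_fun \<Delta> y a + ereal t * g_fun \<Delta> y b"
  \<comment> \<open>If g is \<infinity> at an endpoint, the right-hand side is \<infinity>, because
    both weights are positive.\<close>
  proof (cases rule: g_fun_cases[of a])
    case 1
    then show ?thesis using t by simp
  next
    case (2 v)
    note a = this
    show ?thesis
    proof (cases rule: g_fun_cases[of b])
      case 1
      then show ?thesis using t by simp
    next
      case (2 w)
      \<comment> \<open>The segment between two optimal points stays in the polytope, so its height
        over the intermediate argument bounds g there.\<close>
      have "(1 - t) *\<^sub>R (a, v) + t *\<^sub>R (b, w) \<in> attainable \<Delta> y"
        using convexD[OF convex_attainable a(1) 2(1), of "1 - t" t] t by simp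
      then have "g_fun \<Delta> y ((1 - t) *\<^sub>R a + t *\<^sub>R b) \<le> - ereal ((1 - t) * v + t * w)"
        by (intro g_fun_le) simp
      also have "\<dots> = ereal (1 - t) * g_fun \<Delta> y a + ereal t * g_fun \<Delta> y b"
        using a(2) 2(2) by simp
      finally show ?thesis .
    qed
  qed
qed

text \<open>A linear functional on a polytope is bounded by its maximum over the generators, which
  gives one inequality. Each generator yields a candidate \<beta> in the supremum, which gives the
  other.\<close>

lemma fenchel_dual_g_fun:
  "fenchel_dual (g_fun \<Delta> y) u = (MAX z\<in>sign_vectors. \<Delta> z y + ereal (mismatch y z \<bullet> u))"
    (is "_ = ?M")
proof (rule antisym)
  show "fenchel_dual (g_fun \<Delta> y) u \<le> ?M"
    unfolding fenchel_dual_def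
  proof (rule SUP_least)
    fix \<beta>
    show "ereal (\<beta> \<bullet> u) - g_fun \<Delta> y \<beta> \<le> ?M"
    proof (cases rule: g_fun_cases[of \<beta>])
      case 1
      then show ?thesis by simp
    next
      case (2 v)
      have le: "\<Delta> z y + ereal (mismatch y z \<bullet> u) \<le> ?M" if "z \<in> sign_vectors" for z
        using that by (intro Max_ge) (auto simp: finite_sign_vectors)
      show ?thesis
      proof (cases ?M)
        case (real M)
        have "(\<lambda>z. (mismatch y z, real_of_ereal (\<Delta> z y))) ` {z \<in> sign_vectors. \<Delta> z y \<noteq> - \<infinity>}
            \<subseteq> {q. (u, 1) \<bullet> q \<le> M}"
        proof clarsimp
          fix z assume z: "z \<in> sign_vectors" "\<Delta> z y \<noteq> - \<infinity>"
          then show "u \<bullet> mismatch y z + real_of_ereal (\<Delta> z y) \<le> M"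
            using le[OF z(1)] Delta_not_PInfty[OF z(1)] real
            by (cases "\<Delta> z y") (auto simp: inner_commute)
        qed
        \<comment> \<open>A half-space that contains all generators contains their hull;
          \<open>(u, 1)\<close> encodes the functional
          \<open>\<beta> \<bullet> u + v\<close>.\<close>
        then have "attainable \<Delta> y \<subseteq> {q. (u, 1) \<bullet> q \<le> M}"
          unfolding attainable_def by (intro hull_minimal convex_halfspace_le)
        then have "(u, 1) \<bullet> (\<beta>, v) \<le> M" using 2(1) by blast
        then show ?thesis using 2(2) real by (simp add: inner_commute)
      next
        \<comment> \<open>A maximum of -\<infinity> forces \<Delta> to be -\<infinity> at every sign
          vector. The polytope then has no generators, against the point
          \<open>(\<beta>, v)\<close>.\<close>
        case MInf
        have "\<Delta> z y = - \<infinity>" if "z \<in> sign_vectors" for z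
          using le[OF that] MInf by (cases "\<Delta> z y") auto
        then have "attainable \<Delta> y = {}" by (auto simp: attainable_def)
        with 2 show ?thesis by blast
      qed auto
    qed
  qed
next
  have "sign_vectors \<noteq> ({} :: (real^'n) set)" using y by blast
  moreover have "\<Delta> z y + ereal (mismatch y z \<bullet> u) \<le> fenchel_dual (g_fun \<Delta> y) u"
    if z: "z \<in> sign_vectors" for z
  proof (cases "\<Delta> z y")
    case (real v)
    \<comment> \<open>The supremum is tested at \<beta> = \<open>mismatch y z\<close>, the
      projection of this generator.\<close>
    then have "(mismatch y z, v) \<in> attainable \<Delta> y"
      unfolding attainable_def using z by (intro hull_inc) force
    from g_fun_le[OF this] have "ereal v \<le> - g_fun \<Delta> y (mismatch y z)"
      by (metis ereal_minus_le_minus ereal_uminus_uminus)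
    then have "\<Delta> z y + ereal (mismatch y z \<bullet> u) \<le> ereal (mismatch y z \<bullet> u) - g_fun \<Delta> y (mismatch y z)"
      unfolding real by (subst add.commute) (simp only: minus_ereal_def add_left_mono)
    also have "\<dots> \<le> fenchel_dual (g_fun \<Delta> y) u"
      unfolding fenchel_dual_def by (rule SUP_upper) simp
    finally show ?thesis .
  qed (use Delta_not_PInfty[OF z] in auto)
  ultimately show "?M \<le> fenchel_dual (g_fun \<Delta> y) u"
    by (simp add: finite_sign_vectors)
qed

end

section \<open>The data matrix and the norm bound\<close>

lemma transpose_data_matrix_nth:
  "(transpose (data_matrix x y) *v w) $ i = - 2 / real CARD('n) * y $ i * (w \<bullet> x i)"
  for x :: "'n::finite \<Rightarrow> real^'p::finite"
  unfolding matrix_vector_mult_def transpose_def data_matrix_def inner_vec_def sum_distrib_left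
  by (simp add: mult_ac)

text \<open>Since \<open>y $ i\<close> squares to 1, the product of -2/n, \<open>y $ i\<close> and
  (1 - \<open>z $ i\<close> * \<open>y $ i\<close>)/2 is (\<open>z $ i\<close> -
  \<open>y $ i\<close>)/n. This explains the factor -2/n and the sign in the columns of the
  matrix.\<close>

lemma mismatch_inner_data_matrix:
  fixes x :: "'n::finite \<Rightarrow> real^'p::finite"
  assumes "y \<in> sign_vectors"
  shows "mismatch y z \<bullet> (transpose (data_matrix x y) *v w) =
    1 / real CARD('n) * (\<Sum>i\<in>UNIV. (w \<bullet> x i) * (z $ i - y $ i))"
proof -
  have "mismatch y z $ i * (transpose (data_matrix x y) *v w) $ i =
      1 / real CARD('n) * ((w \<bullet> x i) * (z $ i - y $ i))" for i
    unfolding transpose_data_matrix_nth mismatch_def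
    using sign_nth[OF assms, of i] by (auto simp: field_simps)
  then show ?thesis by (simp add: inner_vec_def sum_distrib_left)
qed

lemma power2_norm_eq_sum_power2: "(norm b)\<^sup>2 = (\<Sum>i\<in>UNIV. (b $ i)\<^sup>2)" for b :: "real^'n::finite"
  unfolding power2_norm_eq_inner inner_vec_def by (simp add: power2_eq_square)

lemma prox_d_max: "max_over (unit_cube :: (real^'n::finite) set) prox_d = real CARD('n) / 2"
proof -
  have "(\<Sum>i\<in>UNIV. (b $ i)\<^sup>2) \<le> (\<Sum>i\<in>(UNIV :: 'n set). 1)" if "b \<in> unit_cube" for b :: "real^'n"
    using that by (intro sum_mono) (auto simp: unit_cube_def power_le_one)
  \<comment> \<open>The all-ones vector turns the bound n on the squared norm into an
    equality.\<close>
  then have "max_over (unit_cube :: (real^'n) set) prox_d = prox_d (1 :: real^'n)"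
    by (intro max_over_eqI) (auto simp: unit_cube_def prox_d_def power2_norm_eq_sum_power2)
  then show ?thesis by (simp add: prox_d_def power2_norm_eq_sum_power2)
qed

text \<open>Moving the matrix to the other side leaves the inner product of \<beta> with
  \<open>u\<close>, whose n coordinates are at most 2R/n in absolute value. Hence its norm is at
  most sqrt n * 2R/n = 2R/sqrt n.\<close>

lemma inner_data_matrix_le:
  fixes x :: "'n::finite \<Rightarrow> real^'p::finite"
  assumes "\<And>i. norm (x i) \<le> R" and "y \<in> sign_vectors" and "norm w = 1" and "norm \<beta> = 1"
  shows "w \<bullet> (data_matrix x y *v \<beta>) \<le> 2 * R / sqrt (real CARD('n))"
proof -
  \<comment> \<open>Needed to take square roots in the bound on \<open>norm u\<close>.\<close>
  have R: "0 \<le> R" using assms(1) norm_ge_zero order_trans by blast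
  define u where "u = transpose (data_matrix x y) *v w"
  have "\<bar>u $ i\<bar> \<le> 2 * R / real CARD('n)" for i
  proof -
    have "\<bar>w \<bullet> x i\<bar> \<le> R"
      using Cauchy_Schwarz_ineq2[of w "x i"] assms(1)[of i] assms(3) by simp
    moreover have "\<bar>y $ i\<bar> = 1" using sign_nth[OF assms(2), of i] by auto
    ultimately show ?thesis
      unfolding u_def transpose_data_matrix_nth by (simp add: abs_mult divide_right_mono)
  qed
  then have "(u $ i)\<^sup>2 \<le> (2 * R / real CARD('n))\<^sup>2" for i
    by (metis abs_le_square_iff abs_of_nonneg abs_ge_zero order_trans)
  then have "(\<Sum>i\<in>UNIV. (u $ i)\<^sup>2) \<le> (\<Sum>i\<in>(UNIV :: 'n set). (2 * R / real CARD('n))\<^sup>2)"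
    by (rule sum_mono)
  also have "\<dots> = (2 * R / sqrt (real CARD('n)))\<^sup>2"
    by (simp add: power_divide power2_eq_square)
  finally have "(norm u)\<^sup>2 \<le> (2 * R / sqrt (real CARD('n)))\<^sup>2"
    by (simp add: power2_norm_eq_sum_power2)
  then have "norm u \<le> 2 * R / sqrt (real CARD('n))"
    by (rule power2_le_imp_le) (use R in simp)
  moreover have "w \<bullet> (data_matrix x y *v \<beta>) = u \<bullet> \<beta>"
    by (simp add: u_def dot_lmul_matrix)
  ultimately show ?thesis
    using Cauchy_Schwarz_ineq2[of u \<beta>] assms(4) by simp
qed

text \<open>The bilinear form is continuous on a product of two unit spheres, which is compact in
  finite dimension. Attainment gives the \<open>max_over\<close> in \<open>mat_norm\<close> its
  intended value.\<close>

lemma mat_norm_attained: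
  fixes A :: "real^'n::finite^'p::finite"
  obtains w \<beta> where "norm w = 1" "norm \<beta> = 1" "mat_norm A = w \<bullet> (A *v \<beta>)"
proof -
  let ?S = "sphere 0 1 \<times> sphere 0 1 :: ((real^'p) \<times> (real^'n)) set"
  have "continuous_on ?S (\<lambda>q. fst q \<bullet> (A *v snd q))"
    by (intro continuous_intros linear_continuous_on_compose[OF _ matrix_vector_mul_linear])
  moreover have "compact ?S" by (intro compact_Times) auto
  \<comment> \<open>Any pair of coordinate vectors shows that the spheres are nonempty;
    \<open>undefined\<close> is merely some index.\<close>
  moreover have "(axis undefined 1, axis undefined 1) \<in> ?S" by (simp add: norm_axis_1)
  then have "?S \<noteq> {}" by blast
  ultimately obtain q where q: "q \<in> ?S" "\<forall>r\<in>?S. fst r \<bullet> (A *v snd r) \<le> fst q \<bullet> (A *v snd q)"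
    using continuous_attains_sup by blast
  have S: "{(w :: real^'p, \<beta> :: real^'n). norm w = 1 \<and> norm \<beta> = 1} = ?S" by auto
  have "mat_norm A = fst q \<bullet> (A *v snd q)"
    unfolding mat_norm_def S by (subst max_over_eqI[of q]) (use q in \<open>auto simp: case_prod_beta\<close>)
  with q(1) show ?thesis by (intro that[of "fst q" "snd q"]) auto
qed

theorem mainTheorem2:
  fixes x :: "'n::finite \<Rightarrow> real^'p::finite"
    and y :: "real^'n"
    and R :: real
    and \<Delta> :: "real^'n \<Rightarrow> real^'n \<Rightarrow> ereal"
  assumes "\<And>i. norm (x i) \<le> R"
    and "y \<in> sign_vectors"
    and "\<And>z. z \<in> sign_vectors \<Longrightarrow> \<Delta> z y \<noteq> \<infinity>"
    and "\<exists>z\<in>sign_vectors. \<Delta> z y \<noteq> - \<infinity>"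
  shows "ereal_convex (g_fun \<Delta> y) \<and>
    (\<forall>w. R_emp \<Delta> x y w = fenchel_dual (g_fun \<Delta> y) (transpose (data_matrix x y) *v w)) \<and>
    sqrt (max_over (unit_cube :: (real^'n) set) prox_d) * mat_norm (data_matrix x y) \<le> sqrt 2 * R"
proof (intro conjI allI)
  show "ereal_convex (g_fun \<Delta> y)"
    using assms(2,3) by (rule ereal_convex_g_fun)
  show "R_emp \<Delta> x y w = fenchel_dual (g_fun \<Delta> y) (transpose (data_matrix x y) *v w)" for w
    \<comment> \<open>At this argument the dual is, term by term, the maximum that defines
      \<open>R_emp\<close>.\<close>
    unfolding R_emp_def fenchel_dual_g_fun[where \<Delta> = \<Delta> and y = y, OF assms(2,3), simplified] mismatch_inner_data_matrix[OF assms(2)] ..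
  obtain w \<beta> where "norm w = 1" "norm \<beta> = 1" "mat_norm (data_matrix x y) = w \<bullet> (data_matrix x y *v \<beta>)"
    by (rule mat_norm_attained)
  then have "mat_norm (data_matrix x y) \<le> 2 * R / sqrt (real CARD('n))"
    using inner_data_matrix_le[OF assms(1,2)] by simp
  \<comment> \<open>Here n/2 is D; its square root cancels the sqrt n in the bound on the matrix
    norm, which makes the result independent of the sample size.\<close>
  then have "sqrt (real CARD('n) / 2) * mat_norm (data_matrix x y) \<le>
      sqrt (real CARD('n) / 2) * (2 * R / sqrt (real CARD('n)))"
    by (rule mult_left_mono) simp
  also have "\<dots> = 2 / sqrt 2 * R"
    by (simp add: real_sqrt_divide)
  also have "\<dots> = sqrt 2 * R"
    by (simp add: real_div_sqrt)
  finally show "sqrt (max_over (unit_cube :: (real^'n) set) prox_d) * mat_norm (data_matrix x y) \<le> sqrt 2 * R"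
    unfolding prox_d_max .
qed

end
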